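(* Let $V=\{v_1,\dots,v_n\}$, let $b$ be an integer with $|b|<\binom{n}{2}$, and let $G$ be a finite simple graph on the vertex set $V$ with no isolated vertices and with $|E(G)|=\frac12\left(\binom{n}{2}-b\right)$. Then $G$ is a quasi $f$-graph of type $(0,b)$ if and only if the complementary graph $\overline{G}$ of $G$ is triangle-free.
   Context: Let $k$ be a field and $R=k[x_1,\dots,x_n]$, the variable $x_i$ corresponding to the vertex $v_i$. For $F\subseteq V$ write $x_F=\prod_{v_i\in F}x_i$. For a square-free monomial ideal $I\subseteq R$ with minimal monomial generating set $G(I)$: the facet complex $\delta_{\mathcal F}(I)$ is the simplicial complex whose facets are the sets $\{v_{i_1},\dots,v_{i_r}\}$ with $x_{i_1}\cdots x_{i_r}\in G(I)$; the non-face complex $\delta_{\mathcal N}(I)$ is $\{F\subseteq V : x_F\notin I\}$. The $f$-vector of a $d$-dimensional simplicial complex is $(f_0,\dots,f_d)$, $f_i$ the number of faces with $i+1$ elements. $I$ is a quasi $f$-ideal of type $(a_1,\dots,a_s)\in\mathbb Z^s$ if $f(\delta_{\mathcal N}(I))-f(\delta_{\mathcal F}(I))=(a_1,\dots,a_s)$, both $f$-vectors lying in $\mathbb Z^s$. A graph $G$ on $V$ is a quasi $f$-graph of type $(0,b)$ if its edge ideal $I(G)=(x_ix_j:\{v_i,v_j\}\in E(G))$ is a quasi $f$-ideal of type $(0,b)$. *)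

theory Defs
  imports Complex_Main "HOL-Library.Poly_Mapping" "HOL-Library.Cardinality"
begin

text \<open>The finite type \<open>'v\<close> is the vertex set, so that \<open>n = CARD('v)\<close>, and
  \<open>('v, 'k) mpol\<close> is the polynomial ring over \<open>'k\<close> with one variable per vertex:
  a polynomial maps exponent vectors to coefficients.\<close>

type_synonym ('v, 'k) mpol = "('v \<Rightarrow>\<^sub>0 nat) \<Rightarrow>\<^sub>0 'k"

definition var :: "'v \<Rightarrow> ('v, 'k::comm_ring_1) mpol" where
  "var i = Poly_Mapping.single (Poly_Mapping.single i 1) 1"

definition sf_monom :: "'v set \<Rightarrow> ('v, 'k::comm_ring_1) mpol" where
  "sf_monom F = (\<Prod>i\<in>F. var i)"

definition monomials :: "('v, 'k::comm_ring_1) mpol set" where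
  "monomials = range (\<lambda>m. Poly_Mapping.single m 1)"

text \<open>Ideals of a commutative ring are its submodules over itself; \<open>ideal.span S\<close> is the
  ideal generated by \<open>S\<close>.\<close>

interpretation ideal: module "(*) :: 'a::comm_ring_1 \<Rightarrow> 'a \<Rightarrow> 'a"
  by standard (simp_all add: algebra_simps)

definition squarefree_monomial_ideal :: "('v, 'k::field) mpol set \<Rightarrow> bool" where
  "squarefree_monomial_ideal I \<longleftrightarrow> (\<exists>\<A>. I = ideal.span (sf_monom ` \<A>))"

definition is_min_monomial_gens :: "('v, 'k::field) mpol set \<Rightarrow> ('v, 'k) mpol set \<Rightarrow> bool" where
  "is_min_monomial_gens B I \<longleftrightarrow>
     B \<subseteq> monomials \<and> ideal.span B = I \<and> (\<forall>B'. B' \<subset> B \<longrightarrow> ideal.span B' \<noteq> I)"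

definition min_monomial_gens :: "('v, 'k::field) mpol set \<Rightarrow> ('v, 'k) mpol set" where
  "min_monomial_gens I = (THE B. is_min_monomial_gens B I)"

definition simplicial_complex :: "'v set set \<Rightarrow> bool" where
  "simplicial_complex \<Delta> \<longleftrightarrow> (\<forall>F\<in>\<Delta>. \<forall>H\<subseteq>F. H \<in> \<Delta>)"

definition facets :: "'v set set \<Rightarrow> 'v set set" where
  "facets \<Delta> = {F\<in>\<Delta>. \<forall>H\<in>\<Delta>. F \<subseteq> H \<longrightarrow> F = H}"

text \<open>That this is the simplicial complex with the prescribed facets is proved in
  \<open>simplicial_complex_facet_complex\<close> and \<open>facets_facet_complex\<close> below; that
  \<open>min_monomial_gens\<close> is well defined is \<open>is_min_monomial_gens_min_monomial_gens\<close>
  with \<open>min_monomial_gens_eqI\<close>.\<close>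

definition facet_complex :: "('v, 'k::field) mpol set \<Rightarrow> 'v set set" where
  "facet_complex I = {F. \<exists>A. sf_monom A \<in> min_monomial_gens I \<and> F \<subseteq> A}"

definition nonface_complex :: "('v, 'k::field) mpol set \<Rightarrow> 'v set set" where
  "nonface_complex I = {F. sf_monom F \<notin> I}"

lemma sf_monom_eq_single:
  "sf_monom A = (Poly_Mapping.single (\<Sum>i\<in>A. Poly_Mapping.single i 1) 1 :: ('v::finite, 'k::field) mpol)"
  unfolding sf_monom_def var_def
  by (induction A rule: infinite_finite_induct) (auto simp: mult_single)

lemma lookup_sum_single:
  "Poly_Mapping.lookup (\<Sum>i\<in>A. Poly_Mapping.single i (1::nat)) j = (if j \<in> A then 1 else 0)"
  for A :: "'v::finite set"
  by (simp add: lookup_sum lookup_single when_def)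

lemma sf_monom_dvd:
  fixes A B :: "'v::finite set"
  assumes "(\<Sum>i\<in>B. Poly_Mapping.single i (1::nat)) = r + (\<Sum>i\<in>A. Poly_Mapping.single i 1)"
  shows "A \<subseteq> B"
proof
  fix i assume "i \<in> A"
  from arg_cong[OF assms, of "\<lambda>m. Poly_Mapping.lookup m i"] this show "i \<in> B"
    unfolding lookup_add lookup_sum_single by (simp split: if_splits)
qed

lemma inj_sf_monom: "inj (sf_monom :: 'v::finite set \<Rightarrow> ('v, 'k::field) mpol)"
proof (rule injI)
  fix A B :: "'v set"
  assume "sf_monom A = (sf_monom B :: ('v, 'k) mpol)"
  hence "(\<Sum>i\<in>A. Poly_Mapping.single i (1::nat)) = (\<Sum>i\<in>B. Poly_Mapping.single i 1)"
    unfolding sf_monom_eq_single by (metis keys_single one_neq_zero singleton_inject)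
  thus "A = B" using sf_monom_dvd[of A 0 B] sf_monom_dvd[of B 0 A] by simp
qed

lemma monomial_in_span:
  fixes S :: "('v \<Rightarrow>\<^sub>0 nat) set"
  assumes "Poly_Mapping.single m (1::'k::field) \<in> ideal.span ((\<lambda>s. Poly_Mapping.single s 1) ` S)"
  shows "\<exists>s\<in>S. \<exists>r. m = r + s"
proof -
  let ?P = "\<lambda>p :: ('v, 'k) mpol. \<forall>k\<in>Poly_Mapping.keys p. \<exists>s\<in>S. \<exists>r. k = r + s"
  have "?P (Poly_Mapping.single m (1::'k))"
    using assms
  proof (induction rule: ideal.span_induct_alt)
    case base thus ?case by simp
  next
    case (step c x y)
    then obtain s' where s: "s' \<in> S" "x = Poly_Mapping.single s' 1" by auto
    show ?case
    proof
      fix k assume "k \<in> Poly_Mapping.keys (c * x + y)"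
      hence "k \<in> Poly_Mapping.keys (c * x) \<or> k \<in> Poly_Mapping.keys y"
        using Poly_Mapping.keys_add[of "c * x" y] by blast
      thus "\<exists>s\<in>S. \<exists>r. k = r + s"
      proof
        assume "k \<in> Poly_Mapping.keys (c * x)"
        then obtain r where "k = r + s'" using keys_mult[of c x] s(2) by auto
        thus ?thesis using s(1) by blast
      qed (use step in blast)
    qed
  qed
  moreover have "m \<in> Poly_Mapping.keys (Poly_Mapping.single m (1::'k))" by simp
  ultimately show ?thesis by blast
qed

lemma min_monomial_gens_exist:
  fixes I :: "('v::finite, 'k::field) mpol set"
  assumes "squarefree_monomial_ideal I"
  obtains \<A> where "is_min_monomial_gens (sf_monom ` \<A>) I"
proof -
  obtain \<A>0 where A0: "I = ideal.span (sf_monom ` \<A>0)"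
    using assms unfolding squarefree_monomial_ideal_def by blast
  define \<A> where "\<A> = arg_min card (\<lambda>\<A>. I = ideal.span (sf_monom ` \<A>))"
  have A: "I = ideal.span (sf_monom ` \<A>)"
    unfolding \<A>_def using A0 by (rule arg_min_natI)
  have le: "card \<A> \<le> card \<B>" if "I = ideal.span (sf_monom ` \<B>)" for \<B>
    unfolding \<A>_def using that by (rule arg_min_nat_le)
  have "ideal.span B' \<noteq> I" if "B' \<subset> sf_monom ` \<A>" for B'
  proof
    assume "ideal.span B' = I"
    moreover from that obtain \<B> where B: "B' = sf_monom ` \<B>" "\<B> \<subseteq> \<A>"
      by (meson psubset_imp_subset subset_imageE)
    moreover have "\<B> \<subset> \<A>" using that B by blast
    hence "card \<B> < card \<A>" by (intro psubset_card_mono) auto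
    ultimately show False using le[of \<B>] by auto
  qed
  moreover have "sf_monom ` \<A> \<subseteq> (monomials :: ('v, 'k) mpol set)"
    by (auto simp: sf_monom_eq_single monomials_def)
  ultimately show thesis using that[of \<A>] A unfolding is_min_monomial_gens_def by blast
qed

lemma min_monomial_gens_dvd:
  fixes I :: "('v::finite, 'k::field) mpol set"
  assumes B: "is_min_monomial_gens B I"
    and "Poly_Mapping.single (r + s) 1 \<in> B" "Poly_Mapping.single s 1 \<in> B"
  shows "r + s = s"
proof (rule ccontr)
  let ?x = "\<lambda>m. Poly_Mapping.single m (1::'k)"
  assume "r + s \<noteq> s"
  hence ne: "?x s \<noteq> ?x (r + s)" by (metis keys_single one_neq_zero singleton_inject)
  have "?x (r + s) = ?x r * ?x s" by (simp add: mult_single)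
  also have "\<dots> \<in> ideal.span (B - {?x (r + s)})"
    using assms(3) ne by (intro ideal.span_scale ideal.span_base) auto
  finally have "ideal.span (insert (?x (r + s)) (B - {?x (r + s)})) = ideal.span (B - {?x (r + s)})"
    unfolding ideal.span_eq by (auto intro: ideal.span_base)
  hence "ideal.span (B - {?x (r + s)}) = I"
    using B assms(2) by (simp add: insert_absorb is_min_monomial_gens_def)
  thus False using B assms(2) unfolding is_min_monomial_gens_def by blast
qed

lemma min_monomial_gens_subset:
  fixes I :: "('v::finite, 'k::field) mpol set"
  assumes B: "is_min_monomial_gens B I" and C: "is_min_monomial_gens C I"
  shows "B \<subseteq> C"
proof
  let ?x = "\<lambda>m. Poly_Mapping.single m (1::'k)"
  have div: "\<exists>s r. ?x s \<in> D \<and> m = r + s"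
    if D: "is_min_monomial_gens D I" and m: "?x m \<in> I" for D m
  proof -
    obtain S where S: "D = ?x ` S"
      using D unfolding is_min_monomial_gens_def monomials_def by (meson subset_imageE)
    have "?x m \<in> ideal.span (?x ` S)" using D m S unfolding is_min_monomial_gens_def by blast
    from monomial_in_span[OF this] show ?thesis unfolding S by blast
  qed
  have inI: "x \<in> I" if "is_min_monomial_gens D I" "x \<in> D" for D x
    using that ideal.span_base unfolding is_min_monomial_gens_def by blast
  fix b assume b: "b \<in> B"
  then obtain m where m: "b = ?x m" using B unfolding is_min_monomial_gens_def monomials_def by auto
  obtain s r where s: "?x s \<in> C" "m = r + s" using div[OF C] inI[OF B b] m by blast
  obtain s' r' where s': "?x s' \<in> B" "s = r' + s'" using div[OF B] inI[OF C s(1)] by blast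
  have "m = (r + r') + s'" using s s' by (simp add: add.assoc)
  hence e: "m = s'" using min_monomial_gens_dvd[OF B, of "r + r'" s'] b m s' by simp
  hence "r + r' = 0" using \<open>m = (r + r') + s'\<close> by simp
  hence "Poly_Mapping.lookup r i + Poly_Mapping.lookup r' i = 0" for i
    by (metis lookup_add lookup_zero)
  hence "r = 0" by (intro poly_mapping_eqI) simp
  thus "b \<in> C" using s m by simp
qed

lemma min_monomial_gens_eqI:
  fixes I :: "('v::finite, 'k::field) mpol set"
  assumes "is_min_monomial_gens B I"
  shows "min_monomial_gens I = B"
  unfolding min_monomial_gens_def
  using assms min_monomial_gens_subset by (intro the_equality) blast+

lemma is_min_monomial_gens_min_monomial_gens:
  fixes I :: "('v::finite, 'k::field) mpol set"
  assumes "squarefree_monomial_ideal I"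
  shows "is_min_monomial_gens (min_monomial_gens I) I"
  using min_monomial_gens_exist[OF assms] min_monomial_gens_eqI by metis

lemma simplicial_complex_facet_complex: "simplicial_complex (facet_complex I)"
  unfolding simplicial_complex_def facet_complex_def by blast

lemma facets_facet_complex:
  fixes I :: "('v::finite, 'k::field) mpol set"
  assumes "squarefree_monomial_ideal I"
  shows "facets (facet_complex I) = {A. sf_monom A \<in> min_monomial_gens I}"
proof -
  have eq: "A = B" if "sf_monom A \<in> min_monomial_gens I" "sf_monom B \<in> min_monomial_gens I" "A \<subseteq> B" for A B
  proof -
    let ?e = "\<lambda>A. \<Sum>i\<in>A. Poly_Mapping.single i (1::nat)"
    have 1: "?e B = ?e (B - A) + ?e A" using that(3) by (simp add: sum.subset_diff)
    have "?e (B - A) + ?e A = ?e A"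
      using min_monomial_gens_dvd[OF is_min_monomial_gens_min_monomial_gens[OF assms], of "?e (B - A)" "?e A"]
        that 1 by (simp add: sf_monom_eq_single)
    hence "B \<subseteq> A" using 1 sf_monom_dvd[of A 0 B] by simp
    thus ?thesis using that by blast
  qed
  show ?thesis
  proof (intro set_eqI iffI)
    fix F assume "F \<in> facets (facet_complex I)"
    thus "F \<in> {A. sf_monom A \<in> min_monomial_gens I}"
      unfolding facets_def facet_complex_def by blast
  next
    fix F assume "F \<in> {A. sf_monom A \<in> min_monomial_gens I}"
    thus "F \<in> facets (facet_complex I)"
      unfolding facets_def facet_complex_def using eq by blast
  qed
qed

lemma simplicial_complex_nonface_complex:
  fixes I :: "('v::finite, 'k::field) mpol set"
  assumes "squarefree_monomial_ideal I"
  shows "simplicial_complex (nonface_complex I)"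
proof -
  obtain \<A> where I: "I = ideal.span (sf_monom ` \<A>)"
    using assms unfolding squarefree_monomial_ideal_def by blast
  have "sf_monom F \<in> I" if "sf_monom H \<in> I" "H \<subseteq> F" for F H
  proof -
    have "sf_monom F = sf_monom (F - H) * (sf_monom H :: ('v, 'k) mpol)"
      unfolding sf_monom_def using that(2) by (intro prod.subset_diff) auto
    thus ?thesis using that(1) ideal.span_scale unfolding I by metis
  qed
  thus ?thesis unfolding simplicial_complex_def nonface_complex_def by blast
qed

text \<open>\<open>dim F = card F - 1\<close>, so that \<open>{{}}\<close> has dimension \<open>-1\<close> and an empty \<open>f\<close>-vector; the
  complex without any face is given dimension \<open>-1\<close> as well.\<close>

definition complex_dim :: "'v::finite set set \<Rightarrow> int" where
  "complex_dim \<Delta> = Max (insert (-1) ((\<lambda>F. int (card F) - 1) ` \<Delta>))"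

definition f_vector :: "'v::finite set set \<Rightarrow> int list" where
  "f_vector \<Delta> = map (\<lambda>i. int (card {F\<in>\<Delta>. card F = i + 1})) [0..<nat (complex_dim \<Delta> + 1)]"

text \<open>The two length conditions are needed because \<open>map2\<close> truncates to the shorter list.\<close>

definition quasi_f_ideal :: "('v::finite, 'k::field) mpol set \<Rightarrow> int list \<Rightarrow> bool" where
  "quasi_f_ideal I a \<longleftrightarrow>
     squarefree_monomial_ideal I \<and>
     length (f_vector (nonface_complex I)) = length a \<and>
     length (f_vector (facet_complex I)) = length a \<and>
     map2 (-) (f_vector (nonface_complex I)) (f_vector (facet_complex I)) = a"

text \<open>A graph on the vertex set \<open>UNIV :: 'v set\<close> is given by its set of edges.\<close>

definition simple_graph :: "'v set set \<Rightarrow> bool" where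
  "simple_graph E \<longleftrightarrow> (\<forall>e\<in>E. card e = 2)"

definition no_isolated_vertices :: "'v set set \<Rightarrow> bool" where
  "no_isolated_vertices E \<longleftrightarrow> (\<forall>v. \<exists>e\<in>E. v \<in> e)"

definition complement_graph :: "'v set set \<Rightarrow> 'v set set" where
  "complement_graph E = {e. card e = 2 \<and> e \<notin> E}"

definition triangle_free :: "'v set set \<Rightarrow> bool" where
  "triangle_free E \<longleftrightarrow>
     \<not> (\<exists>u v w. u \<noteq> v \<and> v \<noteq> w \<and> u \<noteq> w \<and> {u, v} \<in> E \<and> {v, w} \<in> E \<and> {u, w} \<in> E)"

definition edge_ideal :: "'v set set \<Rightarrow> ('v, 'k::field) mpol set" where
  "edge_ideal E = ideal.span {var i * var j | i j. {i, j} \<in> E}"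

text \<open>The coefficient field is passed as a type argument.\<close>

definition quasi_f_graph :: "'k::field itself \<Rightarrow> 'v::finite set set \<Rightarrow> int \<Rightarrow> int \<Rightarrow> bool" where
  "quasi_f_graph K E a b \<longleftrightarrow> quasi_f_ideal (edge_ideal E :: ('v, 'k) mpol set) [a, b]"

end

theory Submission
  imports Defs
begin

text \<open>Without isolated vertices, the facet complex of the edge ideal consists of the subsets of
  edges and the non-face complex of the independent sets. Both contain every vertex, and they
  have \<open>card E\<close> and \<open>(n choose 2) - card E\<close> two-element faces, both positive since
  \<open>\<bar>b\<bar> < (n choose 2)\<close>, with difference \<open>b\<close>. Hence the type is \<open>(0, b)\<close> if and only
  if the non-face complex is one-dimensional, i.e. no three vertices are independent, i.e. the
  complementary graph has no triangle.\<close>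

text \<open>A monomial lying in a monomial ideal is a multiple of one of the generators, and for
  square-free monomials divisibility is inclusion of the index sets.\<close>

lemma sf_monom_in_span_iff:
  fixes \<A> :: "'v::finite set set"
  shows "(sf_monom F :: ('v, 'k::field) mpol) \<in> ideal.span (sf_monom ` \<A>) \<longleftrightarrow> (\<exists>A\<in>\<A>. A \<subseteq> F)"
proof
  let ?e = "\<lambda>A::'v set. \<Sum>i\<in>A. Poly_Mapping.single i (1::nat)"
  have im: "sf_monom ` \<A> = (\<lambda>s. Poly_Mapping.single s (1::'k)) ` ?e ` \<A>"
    by (simp add: image_image sf_monom_eq_single)
  assume "(sf_monom F :: ('v, 'k) mpol) \<in> ideal.span (sf_monom ` \<A>)"
  then obtain A r where "A \<in> \<A>" "?e F = r + ?e A"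
    using monomial_in_span[where 'k = 'k] unfolding im sf_monom_eq_single[of F] by blast
  then show "\<exists>A\<in>\<A>. A \<subseteq> F" using sf_monom_dvd by blast
next
  assume "\<exists>A\<in>\<A>. A \<subseteq> F"
  then obtain A where A: "A \<in> \<A>" "A \<subseteq> F" by blast
  have "sf_monom F = sf_monom (F - A) * (sf_monom A :: ('v, 'k) mpol)"
    unfolding sf_monom_def using A(2) by (intro prod.subset_diff) auto
  with A(1) show "(sf_monom F :: ('v, 'k) mpol) \<in> ideal.span (sf_monom ` \<A>)"
    by (simp add: ideal.span_scale ideal.span_base)
qed

text \<open>If a proper subfamily generated the same ideal, a dropped set \<open>A\<close> would
  have to contain some remaining \<open>B\<close>, which an antichain forbids. Uniqueness of the
  minimal generating set does the rest.\<close>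

lemma min_monomial_gens_span_antichain:
  fixes \<A> :: "'v::finite set set"
  assumes antichain: "\<And>A B. A \<in> \<A> \<Longrightarrow> B \<in> \<A> \<Longrightarrow> A \<subseteq> B \<Longrightarrow> A = B"
  shows "min_monomial_gens (ideal.span (sf_monom ` \<A>) :: ('v, 'k::field) mpol set) = sf_monom ` \<A>"
proof (rule min_monomial_gens_eqI)
  have "ideal.span B' \<noteq> ideal.span (sf_monom ` \<A>)"
    if psub: "B' \<subset> (sf_monom ` \<A> :: ('v, 'k) mpol set)" for B'
  proof
    assume eq: "ideal.span B' = ideal.span (sf_monom ` \<A>)"
    obtain \<B> where \<B>: "B' = sf_monom ` \<B>" "\<B> \<subseteq> \<A>"
      using psub by (meson psubset_imp_subset subset_imageE)
    then obtain A where A: "A \<in> \<A>" "A \<notin> \<B>" using psub by blast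
    have "sf_monom A \<in> ideal.span B'" unfolding eq using A(1) by (simp add: ideal.span_base)
    then obtain B where "B \<in> \<B>" "B \<subseteq> A" unfolding \<B>(1) sf_monom_in_span_iff by blast
    with A \<B>(2) antichain show False by blast
  qed
  then show "is_min_monomial_gens (sf_monom ` \<A>) (ideal.span (sf_monom ` \<A>) :: ('v, 'k) mpol set)"
    unfolding is_min_monomial_gens_def by (auto simp: sf_monom_eq_single monomials_def)
qed

lemma edge_ideal_eq_span_sf_monom:
  assumes "simple_graph E"
  shows "edge_ideal E = (ideal.span (sf_monom ` E) :: ('v, 'k::field) mpol set)"
proof -
  \<comment> \<open>The definition of \<open>edge_ideal\<close> lets \<open>i\<close> and
    \<open>j\<close> coincide, where the product would be a square; edges of cardinality 2 exclude
    this.\<close>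
  have ne: "i \<noteq> j" if "{i, j} \<in> E" for i j
    using assms that unfolding simple_graph_def by force
  have "{var i * var j | i j. {i, j} \<in> E} = (sf_monom ` E :: ('v, 'k) mpol set)"
  proof (intro set_eqI iffI)
    fix p :: "('v, 'k) mpol" assume "p \<in> {var i * var j | i j. {i, j} \<in> E}"
    then obtain i j where ij: "p = var i * var j" "{i, j} \<in> E" by blast
    then have "p = sf_monom {i, j}" using ne by (simp add: sf_monom_def)
    then show "p \<in> sf_monom ` E" using ij(2) by blast
  next
    fix p :: "('v, 'k) mpol" assume "p \<in> sf_monom ` E"
    then obtain e where e: "p = sf_monom e" "e \<in> E" by blast
    then obtain i j where ij: "e = {i, j}" "i \<noteq> j"
      using assms unfolding simple_graph_def card_2_iff by blast
    then have "p = var i * var j" using e(1) by (simp add: sf_monom_def)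
    then show "p \<in> {var i * var j | i j. {i, j} \<in> E}" using e(2) ij(1) by blast
  qed
  then show ?thesis unfolding edge_ideal_def by simp
qed

lemma nonface_complex_edge_ideal:
  fixes E :: "'v::finite set set"
  assumes "simple_graph E"
  shows "nonface_complex (edge_ideal E :: ('v, 'k::field) mpol set) = {F. \<forall>e\<in>E. \<not> e \<subseteq> F}"
  unfolding nonface_complex_def edge_ideal_eq_span_sf_monom[OF assms] sf_monom_in_span_iff by blast

text \<open>Edges all have two elements, so they form an antichain and their monomials are the
  minimal generators; injectivity of \<open>sf_monom\<close> recovers the edge from its
  monomial.\<close>

lemma facet_complex_edge_ideal:
  fixes E :: "'v::finite set set"
  assumes "simple_graph E"
  shows "facet_complex (edge_ideal E :: ('v, 'k::field) mpol set) = {F. \<exists>e\<in>E. F \<subseteq> e}"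
proof -
  have "min_monomial_gens (edge_ideal E :: ('v, 'k) mpol set) = sf_monom ` E"
    unfolding edge_ideal_eq_span_sf_monom[OF assms]
    using assms by (intro min_monomial_gens_span_antichain) (simp add: simple_graph_def card_subset_eq)
  then show ?thesis
    unfolding facet_complex_def by (auto simp: inj_image_mem_iff[OF inj_sf_monom])
qed

text \<open>For \<open>d > 0\<close> the maximum \<open>d - 1\<close> is nonnegative, so it is
  attained by an actual face and not by the default value \<open>-1\<close>, and \<open>nat\<close>
  truncates nothing.\<close>

lemma length_f_vector_eq_iff:
  assumes "d > 0"
  shows "length (f_vector \<Delta>) = d \<longleftrightarrow> (\<forall>F\<in>\<Delta>. card F \<le> d) \<and> (\<exists>F\<in>\<Delta>. card F = d)"
proof -
  have "length (f_vector \<Delta>) = d \<longleftrightarrow> complex_dim \<Delta> = int d - 1"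
    using assms by (auto simp: f_vector_def)
  also have "\<dots> \<longleftrightarrow> (\<forall>F\<in>\<Delta>. card F \<le> d) \<and> (\<exists>F\<in>\<Delta>. card F = d)"
    unfolding complex_dim_def using assms by (subst Max_eq_iff) (auto simp: image_iff)
  finally show ?thesis .
qed

lemma f_vector_eq_pair:
  assumes "length (f_vector \<Delta>) = 2"
  shows "f_vector \<Delta> = [int (card {F\<in>\<Delta>. card F = 1}), int (card {F\<in>\<Delta>. card F = 2})]"
proof -
  have "nat (complex_dim \<Delta> + 1) = 2" using assms by (simp add: f_vector_def)
  then show ?thesis by (simp add: f_vector_def upt_rec numeral_2_eq_2)
qed

text \<open>A triangle in the complement is an independent set of three vertices. Independence
  passes to subsets, so any larger independent set contains such a triple.\<close>

lemma triangle_free_iff: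
  fixes E :: "'v::finite set set"
  assumes "simple_graph E"
  shows "triangle_free (complement_graph E) \<longleftrightarrow> (\<forall>F. (\<forall>e\<in>E. \<not> e \<subseteq> F) \<longrightarrow> card F \<le> 2)"
proof
  assume tf: "triangle_free (complement_graph E)"
  show "\<forall>F. (\<forall>e\<in>E. \<not> e \<subseteq> F) \<longrightarrow> card F \<le> 2"
  proof (intro allI impI, rule ccontr)
    fix F assume F: "\<forall>e\<in>E. \<not> e \<subseteq> F" "\<not> card F \<le> 2"
    then obtain T where "T \<subseteq> F" "card T = 3"
      by (metis not_less_eq_eq numeral_2_eq_2 numeral_3_eq_3 obtain_subset_with_card_n)
    then obtain u v w where "{u, v, w} \<subseteq> F" and ne: "u \<noteq> v" "v \<noteq> w" "u \<noteq> w"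
      unfolding card_3_iff by blast
    then have uvw: "u \<in> F" "v \<in> F" "w \<in> F" by simp_all
    have "{x, y} \<in> complement_graph E" if "x \<in> F" "y \<in> F" "x \<noteq> y" for x y
    proof -
      have "{x, y} \<subseteq> F" using that by simp
      then have "{x, y} \<notin> E" using F(1) by blast
      then show ?thesis using that(3) by (simp add: complement_graph_def)
    qed
    then have "{u, v} \<in> complement_graph E" "{v, w} \<in> complement_graph E" "{u, w} \<in> complement_graph E"
      using uvw ne by simp_all
    with ne tf show False unfolding triangle_free_def by blast
  qed
next
  assume small: "\<forall>F. (\<forall>e\<in>E. \<not> e \<subseteq> F) \<longrightarrow> card F \<le> 2"
  show "triangle_free (complement_graph E)"
    unfolding triangle_free_def
  proof (intro notI, elim exE conjE)
    fix u v w
    assume ne: "u \<noteq> v" "v \<noteq> w" "u \<noteq> w"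
      and co: "{u, v} \<in> complement_graph E" "{v, w} \<in> complement_graph E" "{u, w} \<in> complement_graph E"
    have "\<not> e \<subseteq> {u, v, w}" if "e \<in> E" for e
    proof
      assume sub: "e \<subseteq> {u, v, w}"
      have "card e = 2" using assms that by (simp add: simple_graph_def)
      then obtain x y where xy: "e = {x, y}" "x \<noteq> y" by (auto simp: card_2_iff)
      then have "x \<in> {u, v, w}" "y \<in> {u, v, w}" using sub by simp_all
      \<comment> \<open>An edge inside the triple is one of its three pairs, all of which are
        non-edges.\<close>
      then have "e \<in> {{u, v}, {v, w}, {u, w}}" using xy by (elim insertE emptyE) (simp_all add: insert_commute)
      with co that show False by (auto simp only: complement_graph_def)
    qed
    then have "card {u, v, w} \<le> 2" using small by blast
    with ne show False by simp
  qed
qed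

theorem theorem3p4:
  fixes E :: "'v::finite set set" and b :: int
  assumes "\<bar>b\<bar> < int (CARD('v) choose 2)"
    and "simple_graph E"
    and "no_isolated_vertices E"
    and "real (card E) = 1 / 2 * (real (CARD('v) choose 2) - real_of_int b)"
  shows "quasi_f_graph TYPE('k::field) E 0 b \<longleftrightarrow> triangle_free (complement_graph E)"
proof -
  define I where "I = (edge_ideal E :: ('v, 'k) mpol set)"
  let ?N = "nonface_complex I" and ?C = "facet_complex I"
  have N: "?N = {F. \<forall>e\<in>E. \<not> e \<subseteq> F}" and C: "?C = {F. \<exists>e\<in>E. F \<subseteq> e}"
    unfolding I_def using assms(2) by (rule nonface_complex_edge_ideal facet_complex_edge_ideal)+
  have card2: "card e = 2" if "e \<in> E" for e
    using assms(2) that by (simp add: simple_graph_def)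
  have pairs: "card {F :: 'v set. card F = 2} = CARD('v) choose 2"
    using n_subsets[of "UNIV :: 'v set" 2] by simp
  \<comment> \<open>Clearing the factor 1/2 moves the edge count from the reals to the
    integers.\<close>
  have b: "b = int (CARD('v) choose 2) - 2 * int (card E)"
  proof -
    have "real_of_int b = of_int (int (CARD('v) choose 2) - 2 * int (card E))"
      using assms(4) by simp
    then show ?thesis by (simp only: of_int_eq_iff)
  qed
  have eqE: "e = e'" if "e \<subseteq> e'" "card e = 2" "card e' = 2" for e e' :: "'v set"
    using that by (simp add: card_subset_eq)
  have C2: "{F\<in>?C. card F = 2} = E"
    unfolding C using card2 eqE by blast
  have N2: "{F\<in>?N. card F = 2} = {F. card F = 2} - E"
    unfolding N using card2 eqE by blast
  have "E \<subseteq> {F. card F = 2}" using card2 by blast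
  then have cardN2: "int (card {F\<in>?N. card F = 2}) = int (CARD('v) choose 2) - int (card E)"
    unfolding N2 using pairs card_mono[of "{F :: 'v set. card F = 2}" E]
    by (simp add: card_Diff_subset of_nat_diff)
  \<comment> \<open>Every vertex lies in some edge, so every singleton is a face.\<close>
  have C1: "{F\<in>?C. card F = 1} = {F. card F = 1}"
    unfolding C using assms(3) by (auto simp: no_isolated_vertices_def card_1_singleton_iff)
  have N1: "{F\<in>?N. card F = 1} = {F. card F = 1}"
    unfolding N
  proof (intro set_eqI iffI; clarsimp)
    fix F e :: "'v set" assume "card F = Suc 0" "e \<in> E" "e \<subseteq> F"
    then show False using card2[of e] card_mono[of F e] by simp
  qed
  \<comment> \<open>With m = (n choose 2), the two counts are (m - b)/2 and (m + b)/2, both positive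
    because \<bar>b\<bar> < m.\<close>
  have "card {F\<in>?C. card F = 2} > 0" "card {F\<in>?N. card F = 2} > 0"
    using assms(1) b cardN2 unfolding C2 by linarith+
  then have ex: "\<exists>F\<in>?C. card F = 2" "\<exists>F\<in>?N. card F = 2"
    by (auto simp: card_gt_0_iff)
  have "card F \<le> 2" if "F \<in> ?C" for F
  proof -
    obtain e where "e \<in> E" "F \<subseteq> e" using \<open>F \<in> ?C\<close> unfolding C by blast
    then show ?thesis using card2[of e] card_mono[of e F] by simp
  qed
  then have lenC: "length (f_vector ?C) = 2"
    using ex(1) by (simp add: length_f_vector_eq_iff)
  \<comment> \<open>The vertex counts cancel, and the two-element counts differ by m - 2
    \<open>card E\<close> = b. So the length of \<open>f_vector ?N\<close> is the only condition of
    \<open>quasi_f_ideal\<close> left open.\<close>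
  have "map2 (-) (f_vector ?N) (f_vector ?C) = [0, b]" if "length (f_vector ?N) = 2"
    unfolding f_vector_eq_pair[OF that] f_vector_eq_pair[OF lenC] C1 N1 C2 cardN2 using b by simp
  moreover have "squarefree_monomial_ideal I"
    unfolding I_def squarefree_monomial_ideal_def edge_ideal_eq_span_sf_monom[OF assms(2)] by blast
  ultimately have "quasi_f_graph TYPE('k) E 0 b \<longleftrightarrow> length (f_vector ?N) = 2"
    using lenC unfolding quasi_f_graph_def quasi_f_ideal_def I_def[symmetric] by auto
  \<comment> \<open>An independent pair exists by \<open>ex(2)\<close>, so only the upper bound on
    the size of faces remains.\<close>
  also have "\<dots> \<longleftrightarrow> (\<forall>F\<in>?N. card F \<le> 2)"
    using ex(2) by (simp add: length_f_vector_eq_iff)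
  also have "\<dots> \<longleftrightarrow> triangle_free (complement_graph E)"
    unfolding triangle_free_iff[OF assms(2)] N by simp
  finally show ?thesis .
qed

end
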